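(* For any graphs $H$ and $F$ and for any $n$, we have $\mathrm{ex}(n,H,F)\le \mathrm{rb}(n,H,F)\le \mathrm{ex}(n,H,F)+\mathrm{ex}(n,F)$.
   Context: All graphs are finite and simple. A copy of $H$ in a graph $G$ is a (not necessarily induced) subgraph of $G$ isomorphic to $H$. A graph is $F$-free if it contains no copy of $F$. $\mathrm{ex}(n,H,F)$ is the largest number of copies of $H$ in an $n$-vertex $F$-free graph, and $\mathrm{ex}(n,F)$ is the largest number of edges in an $n$-vertex $F$-free graph. Given a graph $G$ and a family $\mathcal{H}$ of subgraphs of $G$, a subgraph $F$ of $G$ is called rainbow if there is an injection $\phi:E(F)\to\mathcal{H}$ such that each edge $e\in E(F)$ is an edge of $\phi(e)$. $\mathrm{rb}(n,H,F)$ denotes the largest cardinality of a family $\mathcal{H}$ of distinct copies of $H$ in an $n$-vertex graph $G$ such that no copy of $F$ in $G$ is rainbow (the maximum is over all $n$-vertex graphs $G$ and all such families). *)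

theory Defs
  imports Main
begin

text \<open>A graph is a pair of a vertex set and a set of edges, an edge being a two-element vertex set.\<close>

type_synonym 'a graph = "'a set \<times> 'a set set"

abbreviation verts :: "'a graph \<Rightarrow> 'a set" where "verts G \<equiv> fst G"

abbreviation edges :: "'a graph \<Rightarrow> 'a set set" where "edges G \<equiv> snd G"

definition simple_graph :: "'a graph \<Rightarrow> bool" where
  "simple_graph G \<longleftrightarrow> finite (verts G) \<and> (\<forall>e\<in>edges G. e \<subseteq> verts G \<and> card e = 2)"

definition subgraph :: "'a graph \<Rightarrow> 'a graph \<Rightarrow> bool" where
  "subgraph K G \<longleftrightarrow> simple_graph K \<and> verts K \<subseteq> verts G \<and> edges K \<subseteq> edges G"

definition graph_iso :: "'a graph \<Rightarrow> 'b graph \<Rightarrow> bool" where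
  "graph_iso H K \<longleftrightarrow>
     (\<exists>f. bij_betw f (verts H) (verts K) \<and> edges K = (\<lambda>e. f ` e) ` edges H)"

definition copies :: "'a graph \<Rightarrow> 'v graph \<Rightarrow> 'v graph set" where
  "copies H G = {K. subgraph K G \<and> graph_iso H K}"

definition free_of :: "'a graph \<Rightarrow> 'v graph \<Rightarrow> bool" where
  "free_of F G \<longleftrightarrow> copies F G = {}"

definition rainbow :: "'v graph set \<Rightarrow> 'v graph \<Rightarrow> bool" where
  "rainbow \<H> K \<longleftrightarrow>
     (\<exists>\<phi>. inj_on \<phi> (edges K) \<and> \<phi> ` edges K \<subseteq> \<H> \<and> (\<forall>e\<in>edges K. e \<in> edges (\<phi> e)))"

text \<open>
  Every finite graph is isomorphic to one whose vertices are natural numbers, so the host graphs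
  range over graphs on finite sets of naturals. The sets of values below are finite, so
  \<open>Sup\<close> is their maximum when they are nonempty. They can be empty only when \<open>F\<close> has no edges and
  at most \<open>n\<close> vertices, in which case all three numbers are 0.
\<close>

definition n_graph :: "nat \<Rightarrow> nat graph \<Rightarrow> bool" where
  "n_graph n G \<longleftrightarrow> simple_graph G \<and> card (verts G) = n"

definition ex_copies :: "nat \<Rightarrow> 'a graph \<Rightarrow> 'b graph \<Rightarrow> nat" where
  "ex_copies n H F = Sup {card (copies H G) | G. n_graph n G \<and> free_of F G}"

definition ex_edges :: "nat \<Rightarrow> 'b graph \<Rightarrow> nat" where
  "ex_edges n F = Sup {card (edges G) | G. n_graph n G \<and> free_of F G}"

definition rb :: "nat \<Rightarrow> 'a graph \<Rightarrow> 'b graph \<Rightarrow> nat" where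
  "rb n H F = Sup {card \<H> | G \<H>. n_graph n G \<and> \<H> \<subseteq> copies H G \<and>
                                  (\<forall>K\<in>copies F G. \<not> rainbow \<H> K)}"

lemma n_graph_finite_edges:
  assumes "n_graph n G"
  shows "finite (edges G)" and "card (edges G) \<le> 2 ^ n"
proof -
  have sub: "edges G \<subseteq> Pow (verts G)" and fin: "finite (verts G)" and n: "card (verts G) = n"
    using assms by (auto simp: n_graph_def simple_graph_def)
  show "finite (edges G)"
    using sub fin by (meson finite_Pow_iff finite_subset)
  show "card (edges G) \<le> 2 ^ n"
    using card_mono[OF _ sub] fin n by (simp add: card_Pow)
qed

lemma card_copies_le:
  assumes "n_graph n G" "\<H> \<subseteq> copies H G"
  shows "finite \<H>" and "card \<H> \<le> 2 ^ n * 2 ^ 2 ^ n"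
proof -
  let ?S = "Pow (verts G) \<times> Pow (edges G)"
  have fin: "finite (verts G)" "card (verts G) = n"
    using assms by (auto simp: n_graph_def simple_graph_def)
  have sub: "\<H> \<subseteq> ?S"
    using assms(2) by (auto simp: copies_def subgraph_def subset_iff)
  have finS: "finite ?S"
    using fin n_graph_finite_edges(1)[OF assms(1)] by simp
  show "finite \<H>" using sub finS by (rule finite_subset)
  have "card \<H> \<le> card ?S" using finS sub by (rule card_mono)
  also have "\<dots> = 2 ^ n * 2 ^ card (edges G)"
    using fin n_graph_finite_edges(1)[OF assms(1)] by (simp add: card_cartesian_product card_Pow)
  also have "\<dots> \<le> 2 ^ n * 2 ^ 2 ^ n"
    using n_graph_finite_edges(2)[OF assms(1)] by simp
  finally show "card \<H> \<le> 2 ^ n * 2 ^ 2 ^ n" .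
qed

lemma finite_ex_copies_values: "finite {card (copies H G) | G. n_graph n G \<and> free_of F G}"
  by (rule finite_subset[of _ "{..2 ^ n * 2 ^ 2 ^ n}"]) (auto intro: card_copies_le(2))

lemma finite_ex_edges_values: "finite {card (edges G) | G. n_graph n G \<and> free_of F G}"
  by (rule finite_subset[of _ "{..2 ^ n}"]) (auto dest: n_graph_finite_edges(2))

lemma finite_rb_values:
  "finite {card \<H> | G \<H>. n_graph n G \<and> \<H> \<subseteq> copies H G \<and> (\<forall>K\<in>copies F G. \<not> rainbow \<H> K)}"
  by (rule finite_subset[of _ "{..2 ^ n * 2 ^ 2 ^ n}"]) (auto intro: card_copies_le(2))

end

theory Submission
  imports Defs
begin

text \<open>
  For the upper bound, take a largest set \<open>A\<close> of edges of the host graph that can be matched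
  injectively to members of the family containing them. The graph with edge set \<open>A\<close> is rainbow,
  hence \<open>F\<close>-free. If some such matching of \<open>A\<close> misses a member \<open>K\<close> of the family, then all edges
  of \<open>K\<close> lie in \<open>A\<close>, since otherwise \<open>K\<close> could be used to match a further edge. So these \<open>K\<close> are
  copies of \<open>H\<close> in an \<open>F\<close>-free graph, and the remaining members, which every matching of \<open>A\<close> uses,
  number at most \<open>card A\<close>.
\<close>

lemma rainbow_mono:
  assumes "rainbow \<H> K" "edges L \<subseteq> edges K"
  shows "rainbow \<H> L"
  using assms unfolding rainbow_def by (meson image_mono inj_on_subset subset_iff subset_trans)

lemma rainbow_insert:
  assumes "rainbow (\<H> - {K}) (V, A)" "K \<in> \<H>" "e \<in> edges K" "e \<notin> A"
  shows "rainbow \<H> (V, insert e A)"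
proof -
  obtain \<phi> where \<phi>: "inj_on \<phi> A" "\<phi> ` A \<subseteq> \<H> - {K}" "\<forall>d\<in>A. d \<in> edges (\<phi> d)"
    using assms(1) by (auto simp: rainbow_def)
  have "K \<notin> \<phi> ` A" using \<phi>(2) by blast
  moreover have "(\<phi>(e := K)) ` A = \<phi> ` A" using assms(4) by auto
  moreover have "inj_on (\<phi>(e := K)) A" using \<phi>(1) assms(4) by (simp add: inj_on_def)
  ultimately show ?thesis
    unfolding rainbow_def using \<phi> assms(2-4)
    by (intro exI[of _ "\<phi>(e := K)"]) auto
qed

text \<open>One fixed matching suffices: a member outside its image can be removed without harming
  it, so every indispensable member lies in that image.\<close>

lemma card_always_used_le:
  assumes "finite A" "rainbow \<H> (V, A)"
  shows "card {K \<in> \<H>. \<not> rainbow (\<H> - {K}) (V, A)} \<le> card A"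
proof -
  obtain \<phi> where \<phi>: "inj_on \<phi> A" "\<phi> ` A \<subseteq> \<H>" "\<forall>e\<in>A. e \<in> edges (\<phi> e)"
    using assms(2) by (auto simp: rainbow_def)
  have "rainbow (\<H> - {K}) (V, A)" if "K \<notin> \<phi> ` A" for K
    unfolding rainbow_def using \<phi> that by (intro exI[of _ \<phi>]) auto
  then have "{K \<in> \<H>. \<not> rainbow (\<H> - {K}) (V, A)} \<subseteq> \<phi> ` A" by blast
  then show ?thesis using assms(1) by (rule surj_card_le[rotated])
qed

lemma exists_max_rainbow:
  assumes "finite E"
  obtains A where "A \<subseteq> E" "rainbow \<H> (V, A)"
    "\<And>B. B \<subseteq> E \<Longrightarrow> rainbow \<H> (V, B) \<Longrightarrow> card B \<le> card A"
proof -
  let ?P = "\<lambda>A. A \<subseteq> E \<and> rainbow \<H> (V, A)"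
  \<comment> \<open>The empty edge set is matched vacuously, so a maximum exists even for an empty
    family.\<close>
  have "?P {}" by (simp add: rainbow_def)
  moreover have "\<forall>A. ?P A \<longrightarrow> card A < Suc (card E)"
    using card_mono[OF assms] by (auto simp: less_Suc_eq_le)
  ultimately have "\<exists>A. ?P A \<and> (\<forall>B. ?P B \<longrightarrow> card B \<le> card A)"
    by (rule ex_has_greatest_nat)
  then show ?thesis using that by blast
qed

lemma card_copies_le_ex_copies:
  assumes "n_graph n G" "free_of F G"
  shows "card (copies H G) \<le> ex_copies n H F"
  unfolding ex_copies_def using assms
  by (intro cSup_upper bdd_above_finite finite_ex_copies_values) blast

lemma card_edges_le_ex_edges:
  assumes "n_graph n G" "free_of F G"
  shows "card (edges G) \<le> ex_edges n F"
  unfolding ex_edges_def using assms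
  by (intro cSup_upper bdd_above_finite finite_ex_edges_values) blast

lemma card_le_rb:
  assumes "n_graph n G" "\<H> \<subseteq> copies H G" "\<forall>K\<in>copies F G. \<not> rainbow \<H> K"
  shows "card \<H> \<le> rb n H F"
  unfolding rb_def using assms
  by (intro cSup_upper bdd_above_finite finite_rb_values) blast

text \<open>Since \<open>Sup {} = 0\<close> on the naturals, the bound also covers an empty set of
  values.\<close>

lemma Sup_nat_le:
  fixes X :: "nat set"
  assumes "\<And>x. x \<in> X \<Longrightarrow> x \<le> m"
  shows "Sup X \<le> m"
  using assms by (cases "X = {}") (auto intro: cSup_least)

text \<open>In an \<open>F\<close>-free host the family of all copies of \<open>H\<close> is
  admissible for \<open>rb\<close>: there is no copy of \<open>F\<close> that could be
  rainbow.\<close>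

lemma ex_copies_le_rb: "ex_copies n H F \<le> rb n H F"
  unfolding ex_copies_def by (rule Sup_nat_le) (auto simp: free_of_def intro: card_le_rb)

lemma card_rainbow_free_family_le:
  assumes G: "n_graph n G" and \<H>: "\<H> \<subseteq> copies H G"
    and no_rainbow: "\<forall>K\<in>copies F G. \<not> rainbow \<H> K"
  shows "card \<H> \<le> ex_copies n H F + ex_edges n F"
proof -
  define V where "V = verts G"
  have finE: "finite (edges G)" using n_graph_finite_edges(1)[OF G] .
  obtain A where A: "A \<subseteq> edges G" "rainbow \<H> (V, A)"
    and max: "\<And>B. B \<subseteq> edges G \<Longrightarrow> rainbow \<H> (V, B) \<Longrightarrow> card B \<le> card A"
    using exists_max_rainbow[OF finE, where \<H> = \<H> and V = V] by metis
  have finA: "finite A" using A(1) finE by (rule finite_subset)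
  \<comment> \<open>All vertices of \<open>G\<close> are kept, so \<open>(V, A)\<close> can compete
    in both extremal numbers.\<close>
  have VA: "n_graph n (V, A)"
    using G A(1) by (auto simp: n_graph_def simple_graph_def V_def)
  have "K \<notin> copies F (V, A)" for K
  proof
    assume K: "K \<in> copies F (V, A)"
    then have "K \<in> copies F G" using A(1) by (auto simp: copies_def subgraph_def V_def)
    \<comment> \<open>The matching of \<open>A\<close> restricts to the edges of \<open>K\<close>,
      which all lie in \<open>A\<close>.\<close>
    moreover have "rainbow \<H> K"
      using A(2) by (rule rainbow_mono) (use K in \<open>auto simp: copies_def subgraph_def\<close>)
    ultimately show False using no_rainbow by blast
  qed
  then have free: "free_of F (V, A)" by (auto simp: free_of_def)
  let ?R = "{K \<in> \<H>. rainbow (\<H> - {K}) (V, A)}"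
  let ?U = "{K \<in> \<H>. \<not> rainbow (\<H> - {K}) (V, A)}"
  have "edges K \<subseteq> A" if K: "K \<in> ?R" for K
  proof (rule subsetI, rule ccontr)
    fix e assume e: "e \<in> edges K" "e \<notin> A"
    have "rainbow \<H> (V, insert e A)" using K e by (intro rainbow_insert) auto
    moreover have "insert e A \<subseteq> edges G"
      using A(1) e(1) K \<H> by (auto simp: copies_def subgraph_def)
    ultimately have "card (insert e A) \<le> card A" by (rule max[rotated])
    then show False using finA e(2) by simp
  qed
  \<comment> \<open>Isomorphism with \<open>H\<close> concerns \<open>K\<close> alone, so it
    survives shrinking the host to \<open>(V, A)\<close>.\<close>
  then have "?R \<subseteq> copies H (V, A)"
    using \<H> by (fastforce simp: copies_def subgraph_def V_def)
  then have "card ?R \<le> card (copies H (V, A))"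
    using card_copies_le(1)[OF VA order_refl] by (intro card_mono)
  also have "\<dots> \<le> ex_copies n H F" using VA free by (rule card_copies_le_ex_copies)
  finally have R: "card ?R \<le> ex_copies n H F" .
  have "card ?U \<le> card A" using finA A(2) by (rule card_always_used_le)
  also have "\<dots> \<le> ex_edges n F" using card_edges_le_ex_edges[OF VA free] by simp
  finally have U: "card ?U \<le> ex_edges n F" .
  have "?R \<union> ?U = \<H>" by blast
  then have "card \<H> \<le> card ?R + card ?U" using card_Un_le[of ?R ?U] by simp
  then show ?thesis using R U by linarith
qed

theorem lemma2p2:
  fixes H :: "'a graph" and F :: "'b graph" and n :: nat
  assumes "simple_graph H" and "simple_graph F"
  shows "ex_copies n H F \<le> rb n H F \<and> rb n H F \<le> ex_copies n H F + ex_edges n F"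
proof
  show "ex_copies n H F \<le> rb n H F" by (rule ex_copies_le_rb)
  show "rb n H F \<le> ex_copies n H F + ex_edges n F"
    unfolding rb_def by (rule Sup_nat_le) (auto intro: card_rainbow_free_family_le)
qed

end
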